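(* Let $X$ be a separated (Hausdorff) real topological linear space, let $(Z,\preceq)$ be a preordered set, and let $\Psi$ be a non-empty family of functions $\psi\colon Z\to\mathbb{R}\cup\{\pm\infty\}$ which are monotone with respect to $\preceq$. Let $f\colon X\to\mathcal{P}(Z,\Psi)$ be such that for each $\psi\in\Psi$ the function $\psi^\triangle\circ f\colon X\to\mathbb{R}\cup\{\pm\infty\}$ is lower semicontinuous and there is $r_\psi\in\mathbb{R}$ such that $\inf_{x\in X}(\psi^\triangle\circ f)(x)<r_\psi$ and the sublevel set $\{x\in X\mid (\psi^\triangle\circ f)(x)\le r_\psi\}$ is compact. Then, for each $\psi\in\Psi$ there is $x_\psi\in X$ such that \[ (\psi^\triangle\circ f)(x_\psi)=\inf_{x\in X}(\psi^\triangle\circ f)(x). \qquad ( * ) \] Moreover, the set $\{x_\psi\in X\mid \psi\in\Psi,\ x_\psi\text{ satisfies }( * )\text{ for }\psi\}$ is a $(0,\Psi)$-solution of the problem: minimize $f(x)$ over $x\in X$.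
   Context: A function $\psi\colon Z\to\mathbb{R}\cup\{\pm\infty\}$ is monotone if $z_1\preceq z_2$ implies $\psi(z_1)\le\psi(z_2)$. For $D\subseteq Z$, $\psi^\triangle(D)=\inf_{z\in D}\psi(z)$ (with $\inf_{z\in\emptyset}\psi(z)=+\infty$) and $\operatorname{cl}_\Psi D=\bigcap_{\psi\in\Psi}\{z\in Z\mid \psi^\triangle(D)\le\psi(z)\}$; $\mathcal{P}(Z,\Psi)=\{D\subseteq Z\mid D=\operatorname{cl}_\Psi D\}$, ordered by $\supseteq$, is a complete lattice in which $\inf\mathcal{A}=\operatorname{cl}_\Psi\bigcup_{A\in\mathcal{A}}A$. For $M\subseteq X$, $\inf f[M]=\operatorname{cl}_\Psi\bigcup_{x\in M}f(x)$. A non-empty set $M\subseteq X$ is a $(0,\Psi)$-infimizer of $f$ if $\psi^\triangle(\inf f[M])\le\psi^\triangle(\inf f[X])$ for all $\psi\in\Psi$. An element $x\in X$ is a $(0,\Psi)$-minimizer of $f$ if there exists $\psi\in\Psi$ with $\psi^\triangle(f(x))\le\psi^\triangle(\inf f[X])$. (Both inequalities are in $\mathbb{R}\cup\{\pm\infty\}$.) A non-empty set $M\subseteq X$ is a $(0,\Psi)$-solution of the problem if it is a $(0,\Psi)$-infimizer of $f$ and each element of $M$ is a $(0,\Psi)$-minimizer of $f$. *)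

theory Defs
  imports "HOL-Analysis.Analysis"
begin

text \<open>Real topological linear spaces. As in the library classes that this one extends, the
  Hausdorff property is not included; it is expressed by the additional sort
  \<^class>\<open>t2_space\<close>.\<close>

class real_topological_vector = real_vector + topological_ab_group_add +
  assumes tendsto_scaleR_nhds:
    "LIM p (nhds c \<times>\<^sub>F nhds x). fst p *\<^sub>R snd p :> nhds (c *\<^sub>R x)"

instance real_normed_vector \<subseteq> real_topological_vector
proof
  fix c :: real and x :: 'a
  have "((\<lambda>p. fst p *\<^sub>R snd p) \<longlongrightarrow> c *\<^sub>R x) (nhds c \<times>\<^sub>F nhds x)"
    by (rule tendsto_scaleR[OF filterlim_fst filterlim_snd])
  then show "LIM p (nhds c \<times>\<^sub>F nhds x). fst p *\<^sub>R snd p :> nhds (c *\<^sub>R x)" .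
qed

definition lower_semicontinuous :: "('a::topological_space \<Rightarrow> ereal) \<Rightarrow> bool" where
  "lower_semicontinuous g \<longleftrightarrow> (\<forall>x0. \<forall>a < g x0. \<forall>\<^sub>F x in nhds x0. a < g x)"

text \<open>The extension \<open>\<psi>\<^sup>\<triangle>\<close> of \<open>\<psi>\<close> to sets. The convention \<open>\<psi>\<^sup>\<triangle>(\<emptyset>) = +\<infinity>\<close> is the
  library's, see the lemma below.\<close>

definition tri :: "('z \<Rightarrow> ereal) \<Rightarrow> 'z set \<Rightarrow> ereal" where
  "tri \<psi> D = (INF z\<in>D. \<psi> z)"

lemma tri_empty: "tri \<psi> {} = \<infinity>"
  by (simp add: tri_def top_ereal_def)

definition psi_cl :: "('z \<Rightarrow> ereal) set \<Rightarrow> 'z set \<Rightarrow> 'z set" where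
  "psi_cl \<Psi> D = (\<Inter>\<psi>\<in>\<Psi>. {z. tri \<psi> D \<le> \<psi> z})"

definition psi_closed_sets :: "('z \<Rightarrow> ereal) set \<Rightarrow> 'z set set" where
  "psi_closed_sets \<Psi> = {D. D = psi_cl \<Psi> D}"

text \<open>The infimum in the complete lattice \<open>(psi_closed_sets \<Psi>, \<supseteq>)\<close>; note that the order is
  reverse inclusion, so the infimum is the closed hull of the union.\<close>

definition psi_inf :: "('z \<Rightarrow> ereal) set \<Rightarrow> 'z set set \<Rightarrow> 'z set" where
  "psi_inf \<Psi> A = psi_cl \<Psi> (\<Union>A)"

lemma tri_mono: "D \<subseteq> E \<Longrightarrow> tri \<psi> E \<le> tri \<psi> D"
  unfolding tri_def by (rule INF_superset_mono) simp_all

lemma psi_cl_extensive: "D \<subseteq> psi_cl \<Psi> D"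
  by (simp add: psi_cl_def tri_def INF_lower subset_iff)

lemma psi_cl_mono:
  assumes "D \<subseteq> E"
  shows "psi_cl \<Psi> D \<subseteq> psi_cl \<Psi> E"
proof
  fix z assume "z \<in> psi_cl \<Psi> D"
  then have D: "tri \<psi> D \<le> \<psi> z" if "\<psi> \<in> \<Psi>" for \<psi>
    using that by (simp add: psi_cl_def)
  have "tri \<psi> E \<le> \<psi> z" if "\<psi> \<in> \<Psi>" for \<psi>
    by (rule order_trans[OF tri_mono[OF assms] D[OF that]])
  then show "z \<in> psi_cl \<Psi> E"
    by (simp add: psi_cl_def)
qed

lemma tri_psi_cl:
  assumes "\<psi> \<in> \<Psi>"
  shows "tri \<psi> (psi_cl \<Psi> D) = tri \<psi> D"
proof (rule antisym)
  show "tri \<psi> (psi_cl \<Psi> D) \<le> tri \<psi> D"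
    by (rule tri_mono[OF psi_cl_extensive])
  have "tri \<psi> D \<le> \<psi> z" if "z \<in> psi_cl \<Psi> D" for z
    using that assms by (simp add: psi_cl_def)
  then show "tri \<psi> D \<le> tri \<psi> (psi_cl \<Psi> D)"
    by (subst (2) tri_def) (rule INF_greatest)
qed

lemma psi_cl_idem: "psi_cl \<Psi> (psi_cl \<Psi> D) = psi_cl \<Psi> D"
proof -
  have "psi_cl \<Psi> (psi_cl \<Psi> D) = (\<Inter>\<psi>\<in>\<Psi>. {z. tri \<psi> (psi_cl \<Psi> D) \<le> \<psi> z})"
    by (rule psi_cl_def)
  also have "\<dots> = (\<Inter>\<psi>\<in>\<Psi>. {z. tri \<psi> D \<le> \<psi> z})"
    by (rule INF_cong) (simp_all add: tri_psi_cl)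
  also have "\<dots> = psi_cl \<Psi> D"
    by (rule psi_cl_def[symmetric])
  finally show ?thesis .
qed

lemma psi_inf_in: "psi_inf \<Psi> A \<in> psi_closed_sets \<Psi>"
  by (simp add: psi_inf_def psi_closed_sets_def psi_cl_idem)

lemma psi_inf_lower: "D \<in> A \<Longrightarrow> psi_inf \<Psi> A \<supseteq> D"
  unfolding psi_inf_def by (rule order_trans[OF Union_upper psi_cl_extensive])

lemma psi_inf_greatest:
  assumes "E \<in> psi_closed_sets \<Psi>" and "\<And>D. D \<in> A \<Longrightarrow> E \<supseteq> D"
  shows "E \<supseteq> psi_inf \<Psi> A"
proof -
  have "psi_cl \<Psi> (\<Union>A) \<subseteq> psi_cl \<Psi> E"
    by (rule psi_cl_mono[OF Union_least[OF assms(2)]])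
  with assms(1) show ?thesis
    by (simp add: psi_inf_def psi_closed_sets_def)
qed

text \<open>Solution notions (with tolerance 0) for the problem of minimizing \<open>f x\<close> over all \<open>x\<close>.\<close>

definition zero_infimizer ::
  "('z \<Rightarrow> ereal) set \<Rightarrow> ('x \<Rightarrow> 'z set) \<Rightarrow> 'x set \<Rightarrow> bool" where
  "zero_infimizer \<Psi> f M \<longleftrightarrow>
     M \<noteq> {} \<and> (\<forall>\<psi>\<in>\<Psi>. tri \<psi> (psi_inf \<Psi> (f ` M)) \<le> tri \<psi> (psi_inf \<Psi> (range f)))"

definition zero_minimizer ::
  "('z \<Rightarrow> ereal) set \<Rightarrow> ('x \<Rightarrow> 'z set) \<Rightarrow> 'x \<Rightarrow> bool" where
  "zero_minimizer \<Psi> f x \<longleftrightarrow> (\<exists>\<psi>\<in>\<Psi>. tri \<psi> (f x) \<le> tri \<psi> (psi_inf \<Psi> (range f)))"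

definition zero_solution ::
  "('z \<Rightarrow> ereal) set \<Rightarrow> ('x \<Rightarrow> 'z set) \<Rightarrow> 'x set \<Rightarrow> bool" where
  "zero_solution \<Psi> f M \<longleftrightarrow>
     M \<noteq> {} \<and> zero_infimizer \<Psi> f M \<and> (\<forall>x\<in>M. zero_minimizer \<Psi> f x)"

end

theory Submission
  imports Defs
begin

text \<open>Each scalarization \<open>tri \<psi> \<circ> f\<close> attains its infimum by the Weierstrass argument: a lower
  semicontinuous function with a compact sublevel set at a level strictly above its infimum has a
  minimizer (\<open>lower_semicontinuous_attains_INF\<close>). What links these scalar problems with the
  set-valued one is that \<open>tri \<psi>\<close> turns infima in the lattice of closed sets into infima of
  extended reals (\<open>tri_psi_inf_image\<close>), because closure does not change \<open>tri \<psi>\<close> and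
  \<open>tri \<psi>\<close> of a union is the infimum of the values on its members. Hence the lattice infimum
  over the whole space has \<open>tri \<psi>\<close>-value equal to the scalar infimum. A set which contains,
  for every \<open>\<psi>\<close>, a scalar minimizer for \<open>\<psi>\<close> therefore reaches these values and is an
  infimizer, and a scalar minimizer for a single \<open>\<psi>\<close> is a minimizer, with that \<open>\<psi>\<close> as
  witness.\<close>

lemma open_superlevel_lower_semicontinuous:
  assumes "lower_semicontinuous g"
  shows "open {x. a < g x}"
proof (subst open_subopen, rule ballI)
  fix x assume "x \<in> {x. a < g x}"
  with assms have "\<forall>\<^sub>F y in nhds x. a < g y"
    by (simp add: lower_semicontinuous_def)
  then obtain S where "open S" "x \<in> S" "\<forall>y\<in>S. a < g y"
    unfolding eventually_nhds by (elim exE conjE)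
  then show "\<exists>T. open T \<and> x \<in> T \<and> T \<subseteq> {x. a < g x}"
    by (intro exI[of _ S]) auto
qed

text \<open>If the infimum \<open>m\<close> were not attained, the open superlevel sets with levels above \<open>m\<close>
  would cover the whole space. Finitely many of them cover the compact sublevel set, and the smallest
  of their levels bounds the function from below there, although it exceeds \<open>m\<close>.\<close>

lemma lower_semicontinuous_attains_INF:
  fixes g :: "'a::topological_space \<Rightarrow> ereal"
  assumes lsc: "lower_semicontinuous g"
    and less: "(INF x. g x) < r"
    and compact: "compact {x. g x \<le> r}"
  shows "\<exists>x. g x = (INF y. g y)"
proof (rule ccontr)
  define m where "m = (INF x. g x)"
  assume not_attained: "\<not> ?thesis"
  have above: "m < g x" for x
    using not_attained INF_lower[of x UNIV g] by (auto simp: m_def less_le)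
  have cover: "{x. g x \<le> r} \<subseteq> (\<Union>a\<in>{m<..}. {x. a < g x})"
  proof
    fix x
    show "x \<in> (\<Union>a\<in>{m<..}. {x. a < g x})"
      using dense[OF above[of x]] by auto
  qed
  obtain A where A: "A \<subseteq> {m<..}" "finite A" "{x. g x \<le> r} \<subseteq> (\<Union>a\<in>A. {x. a < g x})"
    by (rule compactE_image[OF compact open_superlevel_lower_semicontinuous[OF lsc] cover])
  \<comment> \<open>Including \<open>r\<close> keeps a point below the level \<open>b\<close> in the compact set, and makes the
    minimum meaningful when \<open>A\<close> is empty.\<close>
  define b where "b = Min (insert r A)"
  have "m < b"
    using A(1,2) less by (auto simp: b_def m_def)
  then obtain x where x: "g x < b"
    by (auto simp: m_def INF_less_iff)
  have "b \<le> r" and b_le: "a \<in> A \<Longrightarrow> b \<le> a" for a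
    using A(2) by (auto simp: b_def)
  with x have "g x \<le> r"
    by order
  with A(3) obtain a where "a \<in> A" "a < g x"
    by blast
  with b_le[OF \<open>a \<in> A\<close>] x show False
    by order
qed

lemma tri_Union: "tri \<psi> (\<Union>A) = (INF D\<in>A. tri \<psi> D)"
proof (rule antisym)
  show "tri \<psi> (\<Union>A) \<le> (INF D\<in>A. tri \<psi> D)"
    by (rule INF_greatest) (rule tri_mono[OF Union_upper])
  have "(INF D\<in>A. tri \<psi> D) \<le> \<psi> z" if "z \<in> D" "D \<in> A" for z D
    by (rule INF_lower2[OF \<open>D \<in> A\<close>], unfold tri_def) (rule INF_lower[OF \<open>z \<in> D\<close>])
  then show "(INF D\<in>A. tri \<psi> D) \<le> tri \<psi> (\<Union>A)"
    by (subst (2) tri_def) (rule INF_greatest, erule UnionE)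
qed

lemma tri_psi_inf_image:
  assumes "\<psi> \<in> \<Psi>"
  shows "tri \<psi> (psi_inf \<Psi> (f ` M)) = (INF x\<in>M. tri \<psi> (f x))"
  by (simp add: psi_inf_def tri_psi_cl[OF assms] tri_Union image_image)

theorem theorem4p2:
  fixes \<Psi> :: "('z::preorder \<Rightarrow> ereal) set"
    and f :: "'x::{real_topological_vector, t2_space} \<Rightarrow> 'z set"
  assumes "\<Psi> \<noteq> {}"
    and "\<And>\<psi>. \<psi> \<in> \<Psi> \<Longrightarrow> monotone (\<le>) (\<le>) \<psi>"
    and "\<And>x. f x \<in> psi_closed_sets \<Psi>"
    and "\<And>\<psi>. \<psi> \<in> \<Psi> \<Longrightarrow> lower_semicontinuous (tri \<psi> \<circ> f)"
    and "\<And>\<psi>. \<psi> \<in> \<Psi> \<Longrightarrow>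
           \<exists>r::real. (INF x. (tri \<psi> \<circ> f) x) < ereal r \<and> compact {x. (tri \<psi> \<circ> f) x \<le> ereal r}"
  shows "(\<forall>\<psi>\<in>\<Psi>. \<exists>x. (tri \<psi> \<circ> f) x = (INF y. (tri \<psi> \<circ> f) y)) \<and>
         zero_solution \<Psi> f {x. \<exists>\<psi>\<in>\<Psi>. (tri \<psi> \<circ> f) x = (INF y. (tri \<psi> \<circ> f) y)}"
    (is "?attained \<and> zero_solution \<Psi> f ?M")
proof
  show attained: ?attained
  proof
    fix \<psi> assume "\<psi> \<in> \<Psi>"
    obtain r :: real where "(INF x. (tri \<psi> \<circ> f) x) < ereal r"
      and "compact {x. (tri \<psi> \<circ> f) x \<le> ereal r}"
      using assms(5)[OF \<open>\<psi> \<in> \<Psi>\<close>] by (elim exE conjE)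
    then show "\<exists>x. (tri \<psi> \<circ> f) x = (INF y. (tri \<psi> \<circ> f) y)"
      by (rule lower_semicontinuous_attains_INF[OF assms(4)[OF \<open>\<psi> \<in> \<Psi>\<close>]])
  qed
  with assms(1) have nonempty: "?M \<noteq> {}"
    by blast
  have "tri \<psi> (psi_inf \<Psi> (f ` ?M)) \<le> tri \<psi> (psi_inf \<Psi> (range f))" if "\<psi> \<in> \<Psi>" for \<psi>
  proof -
    obtain x where x: "(tri \<psi> \<circ> f) x = (INF y. (tri \<psi> \<circ> f) y)"
      using attained \<open>\<psi> \<in> \<Psi>\<close> by blast
    with \<open>\<psi> \<in> \<Psi>\<close> have "x \<in> ?M"
      by blast
    then have "(INF y\<in>?M. tri \<psi> (f y)) \<le> tri \<psi> (f x)"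
      by (rule INF_lower)
    with x show ?thesis
      by (simp add: tri_psi_inf_image[OF \<open>\<psi> \<in> \<Psi>\<close>])
  qed
  with nonempty have "zero_infimizer \<Psi> f ?M"
    by (simp add: zero_infimizer_def)
  moreover have "\<forall>x\<in>?M. zero_minimizer \<Psi> f x"
  proof
    fix x assume "x \<in> ?M"
    then obtain \<psi> where "\<psi> \<in> \<Psi>" and "(tri \<psi> \<circ> f) x = (INF y. (tri \<psi> \<circ> f) y)"
      by blast
    then have "tri \<psi> (f x) \<le> tri \<psi> (psi_inf \<Psi> (range f))"
      by (simp add: tri_psi_inf_image)
    with \<open>\<psi> \<in> \<Psi>\<close> show "zero_minimizer \<Psi> f x"
      unfolding zero_minimizer_def by (intro bexI[of _ \<psi>])
  qed
  ultimately show "zero_solution \<Psi> f ?M"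
    using nonempty by (simp add: zero_solution_def)
qed

end
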